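(* Let $X$ be the transient homogeneous diffusion with coefficients $a,b$ described in the context, and for $x\in\mathbb{R}$ let $$\psi_x(0)=\psi^{x,+}(0)+\psi^{x,-}(0),\qquad \psi^{x,\pm}(0)=\pm\frac12\lim_{\lambda\downarrow 0}\frac{y_{\lambda,\pm}'(x)}{y_{\lambda,\pm}(x)},$$ where $y_{\lambda,+}$ and $y_{\lambda,-}$ are the increasing and decreasing solutions of $\mathcal{L}y=\lambda y$ specified in the context. (This is the parameter for which $\mathsf{P}(L^x_\infty(x)>l)=\exp(-l\,\psi_x(0))$ for all $l\ge 0$.) Then for every $x\in\mathbb{R}$ $$\psi_x(0)=\frac12\left(\frac{1}{\Phi(x,+\infty)}-\frac{1}{\Phi(x,-\infty)}\right),$$ where $\frac{1}{\infty}:=0$ (that is, $1/(\pm\infty)=0$).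
   Context: On a complete filtered probability space $(\Omega,\mathcal{F},\{\mathcal{F}_t\}_{t\ge0},\mathsf{P})$ with a standard $\mathcal{F}_t$-Wiener process $W$, consider the family $\{X^x_t,\,t\ge 0,\,x\in\mathbb{R}\}$ of one-dimensional homogeneous diffusion processes $$dX^x_t=b(X^x_t)\,dt+a(X^x_t)\,dW_t,\quad t\ge 0,\qquad X_0^x=x.$$ The coefficients $a,b:\mathbb{R}\to\mathbb{R}$ are continuous, $a(x)\ne 0$ for all $x\in\mathbb{R}$, and they are such that a non-explosive weak solution on $\mathbb{R}$ exists. Generator: $\mathcal{L}f(x)=\frac{a(x)^2}{2}f''(x)+b(x)f'(x)$ for $f\in C^2(\mathbb{R})$. Define $\varphi(x_0,x)=\exp\left\{-2\int_{x_0}^{x}\frac{b(u)}{a(u)^2}\,du\right\}$ and $\Phi(x_0,x)=\int_{x_0}^x\varphi(x_0,z)\,dz$ for $x_0,x\in\mathbb{R}$, and $\Phi(x_0,\pm\infty)=\lim_{x\to\pm\infty}\Phi(x_0,x)$, so that $\Phi(x_0,+\infty)\in(0,+\infty]$ and $\Phi(x_0,-\infty)\in[-\infty,0)$. Transience assumption: at least one of $\Phi(x_0,+\infty)$, $\Phi(x_0,-\infty)$ is finite (for some, equivalently all, $x_0\in\mathbb{R}$). Local time: $L^x_t(y)=a(y)^2\lim_{\varepsilon\downarrow 0}\frac{1}{2\varepsilon}\int_0^t\mathbb{I}\{|X^x_s-y|\le\varepsilon\}\,ds$ (the limit exists almost surely), and $L^x_\infty(y)=\lim_{t\to+\infty}L^x_t(y)$.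 Hitting times: $\tau^x_y=\inf\{t\ge 0: X^x_t=y\}$, with $\inf\varnothing=+\infty$ and $e^{-\lambda\cdot(+\infty)}=0$ for $\lambda>0$. For fixed $\lambda>0$, $y_{\lambda,+}$ and $y_{\lambda,-}$ are respectively the (positive) increasing and decreasing solutions of $\mathcal{L}y=\lambda y$ on $\mathbb{R}$, normalized by $y_{\lambda,\pm}(0)=1$; they have the probabilistic representations $y_{\lambda,+}(x)=\mathsf{E}\,e^{-\lambda\tau^x_0}$ for $x<0$ and $y_{\lambda,+}(x)=(\mathsf{E}\,e^{-\lambda\tau^0_x})^{-1}$ for $x\ge 0$; $y_{\lambda,-}(x)=\mathsf{E}\,e^{-\lambda\tau^x_0}$ for $x\ge 0$ and $y_{\lambda,-}(x)=(\mathsf{E}\,e^{-\lambda\tau^0_x})^{-1}$ for $x<0$. *)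

theory Defs
  imports "HOL-Probability.Probability"
begin

section \<open>Filtered probability spaces and Wiener processes\<close>

text \<open>
  The library's filtrations are indexed by a whole linear order. Here the order is \<^typ>\<open>real\<close>;
  the indices below \<open>0\<close> play no role (one may always take \<open>F t = F 0\<close> there).
\<close>

definition complete_filtered_prob_space :: "'w measure \<Rightarrow> (real \<Rightarrow> 'w measure) \<Rightarrow> bool" where
  "complete_filtered_prob_space M F \<longleftrightarrow>
     prob_space M \<and> complete_measure M \<and> filtration (space M) F \<and>
     (\<forall>t. sets (F t) \<subseteq> sets M) \<and> null_sets M \<subseteq> sets (F 0)"

definition adapted_process :: "(real \<Rightarrow> 'w measure) \<Rightarrow> (real \<Rightarrow> 'w \<Rightarrow> real) \<Rightarrow> bool" where
  "adapted_process F Y \<longleftrightarrow> (\<forall>t\<ge>0. Y t \<in> borel_measurable (F t))"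

definition continuous_process :: "'w measure \<Rightarrow> (real \<Rightarrow> 'w \<Rightarrow> real) \<Rightarrow> bool" where
  "continuous_process M Y \<longleftrightarrow> (AE \<omega> in M. continuous_on {0..} (\<lambda>t. Y t \<omega>))"

definition wiener_process ::
  "'w measure \<Rightarrow> (real \<Rightarrow> 'w measure) \<Rightarrow> (real \<Rightarrow> 'w \<Rightarrow> real) \<Rightarrow> bool" where
  "wiener_process M F W \<longleftrightarrow>
     adapted_process F W \<and> continuous_process M W \<and> (AE \<omega> in M. W 0 \<omega> = 0) \<and>
     (\<forall>s t. 0 \<le> s \<and> s < t \<longrightarrow>
        distributed M lborel (\<lambda>\<omega>. W t \<omega> - W s \<omega>) (normal_density 0 (sqrt (t - s))) \<and>
        prob_space.indep_set M (sets (F s))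
          {(\<lambda>\<omega>. W t \<omega> - W s \<omega>) -` B \<inter> space M | B. B \<in> sets borel})"

section \<open>The Ito integral\<close>

definition tendsto_in_prob ::
  "'w measure \<Rightarrow> (nat \<Rightarrow> 'w \<Rightarrow> real) \<Rightarrow> ('w \<Rightarrow> real) \<Rightarrow> bool" where
  "tendsto_in_prob M Y Z \<longleftrightarrow>
     (\<forall>k. Y k \<in> borel_measurable M) \<and> Z \<in> borel_measurable M \<and>
     (\<forall>\<epsilon>>0. (\<lambda>k. measure M {\<omega> \<in> space M. \<epsilon> \<le> \<bar>Y k \<omega> - Z \<omega>\<bar>}) \<longlonglongrightarrow> 0)"

text \<open>
  A simple process on \<open>[0, t]\<close> is given by a grid \<open>0 = \<theta> 0 \<le> \<dots> \<le> \<theta> n = t\<close> and bounded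
  \<open>F (\<theta> i)\<close>-measurable heights \<open>\<xi> i\<close>, the value on \<open>(\<theta> i, \<theta> (i + 1)]\<close> being \<open>\<xi> i\<close>.
\<close>

definition simple_process ::
  "(real \<Rightarrow> 'w measure) \<Rightarrow> real \<Rightarrow> nat \<Rightarrow> (nat \<Rightarrow> real) \<Rightarrow> (nat \<Rightarrow> 'w \<Rightarrow> real) \<Rightarrow> bool" where
  "simple_process F t n \<theta> \<xi> \<longleftrightarrow>
     \<theta> 0 = 0 \<and> \<theta> n = t \<and>
     (\<forall>i<n. \<theta> i \<le> \<theta> (Suc i) \<and> \<xi> i \<in> borel_measurable (F (\<theta> i)) \<and>
        (\<exists>C. \<forall>\<omega> \<in> space (F (\<theta> i)). \<bar>\<xi> i \<omega>\<bar> \<le> C))"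

definition simple_value ::
  "nat \<Rightarrow> (nat \<Rightarrow> real) \<Rightarrow> (nat \<Rightarrow> 'w \<Rightarrow> real) \<Rightarrow> real \<Rightarrow> 'w \<Rightarrow> real" where
  "simple_value n \<theta> \<xi> s \<omega> = (\<Sum>i<n. \<xi> i \<omega> * indicator {\<theta> i<..\<theta> (Suc i)} s)"

definition simple_integral ::
  "(real \<Rightarrow> 'w \<Rightarrow> real) \<Rightarrow> nat \<Rightarrow> (nat \<Rightarrow> real) \<Rightarrow> (nat \<Rightarrow> 'w \<Rightarrow> real) \<Rightarrow> 'w \<Rightarrow> real" where
  "simple_integral W n \<theta> \<xi> \<omega> = (\<Sum>i<n. \<xi> i \<omega> * (W (\<theta> (Suc i)) \<omega> - W (\<theta> i) \<omega>))"

text \<open>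
  \<open>has_ito_integral M F W H t I\<close>: the integrand \<open>H\<close> has almost surely square-integrable paths on
  \<open>[0, t]\<close>, and \<open>I\<close> is (a version of) the stochastic integral of \<open>H\<close> against \<open>W\<close> over
  \<open>[0, t]\<close>, that is, the limit in probability of the integrals of simple processes approximating
  \<open>H\<close> in the pathwise square mean, in probability.
\<close>

definition has_ito_integral ::
  "'w measure \<Rightarrow> (real \<Rightarrow> 'w measure) \<Rightarrow> (real \<Rightarrow> 'w \<Rightarrow> real) \<Rightarrow> (real \<Rightarrow> 'w \<Rightarrow> real) \<Rightarrow>
   real \<Rightarrow> ('w \<Rightarrow> real) \<Rightarrow> bool" where
  "has_ito_integral M F W H t I \<longleftrightarrow>
     adapted_process F H \<and>
     (AE \<omega> in M. set_borel_measurable lborel {0..t} (\<lambda>s. H s \<omega>) \<and>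
                 set_integrable lborel {0..t} (\<lambda>s. (H s \<omega>)\<^sup>2)) \<and>
     (\<exists>n \<theta> \<xi>.
        (\<forall>k. simple_process F t (n k) (\<theta> k) (\<xi> k)) \<and>
        tendsto_in_prob M
          (\<lambda>k \<omega>. LINT s:{0..t}|lborel. (simple_value (n k) (\<theta> k) (\<xi> k) s \<omega> - H s \<omega>)\<^sup>2)
          (\<lambda>_. 0) \<and>
        tendsto_in_prob M (\<lambda>k. simple_integral W (n k) (\<theta> k) (\<xi> k)) I)"

section \<open>The diffusion, its generator and its scale function\<close>

text \<open>
  Non-explosion is built in: the solution is real valued and has continuous paths on all of
  \<open>[0, \<infinity>)\<close>.
\<close>

definition sde_solution ::
  "'w measure \<Rightarrow> (real \<Rightarrow> 'w measure) \<Rightarrow> (real \<Rightarrow> 'w \<Rightarrow> real) \<Rightarrow> (real \<Rightarrow> real) \<Rightarrow> (real \<Rightarrow> real) \<Rightarrow>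
   real \<Rightarrow> (real \<Rightarrow> 'w \<Rightarrow> real) \<Rightarrow> bool" where
  "sde_solution M F W a b x Y \<longleftrightarrow>
     adapted_process F Y \<and> continuous_process M Y \<and> (AE \<omega> in M. Y 0 \<omega> = x) \<and>
     (\<forall>t\<ge>0. \<exists>I. has_ito_integral M F W (\<lambda>s \<omega>. a (Y s \<omega>)) t I \<and>
        (AE \<omega> in M. Y t \<omega> = x + (LINT s:{0..t}|lborel. b (Y s \<omega>)) + I \<omega>))"

definition C2 :: "(real \<Rightarrow> real) \<Rightarrow> bool" where
  "C2 f \<longleftrightarrow> f differentiable_on UNIV \<and> deriv f differentiable_on UNIV \<and>
            continuous_on UNIV (deriv (deriv f))"

definition generator ::
  "(real \<Rightarrow> real) \<Rightarrow> (real \<Rightarrow> real) \<Rightarrow> (real \<Rightarrow> real) \<Rightarrow> real \<Rightarrow> real" where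
  "generator a b f x = (a x)\<^sup>2 / 2 * deriv (deriv f) x + b x * deriv f x"

text \<open>The interval integrals are oriented, so \<open>x < x0\<close> is covered.\<close>

definition phi :: "(real \<Rightarrow> real) \<Rightarrow> (real \<Rightarrow> real) \<Rightarrow> real \<Rightarrow> real \<Rightarrow> real" where
  "phi a b x0 x = exp (- 2 * (LBINT u=x0..x. b u / (a u)\<^sup>2))"

definition Phi :: "(real \<Rightarrow> real) \<Rightarrow> (real \<Rightarrow> real) \<Rightarrow> real \<Rightarrow> real \<Rightarrow> real" where
  "Phi a b x0 x = (LBINT z=x0..x. phi a b x0 z)"

definition Phi_pinf :: "(real \<Rightarrow> real) \<Rightarrow> (real \<Rightarrow> real) \<Rightarrow> real \<Rightarrow> ereal" where
  "Phi_pinf a b x0 = Lim at_top (\<lambda>x. ereal (Phi a b x0 x))"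

definition Phi_minf :: "(real \<Rightarrow> real) \<Rightarrow> (real \<Rightarrow> real) \<Rightarrow> real \<Rightarrow> ereal" where
  "Phi_minf a b x0 = Lim at_bot (\<lambda>x. ereal (Phi a b x0 x))"

definition transient_coeffs :: "(real \<Rightarrow> real) \<Rightarrow> (real \<Rightarrow> real) \<Rightarrow> bool" where
  "transient_coeffs a b \<longleftrightarrow>
     (\<exists>x0. \<bar>Phi_pinf a b x0\<bar> \<noteq> \<infinity> \<or> \<bar>Phi_minf a b x0\<bar> \<noteq> \<infinity>)"

section \<open>Hitting times and the monotone eigenfunctions\<close>

definition hitting_time :: "(real \<Rightarrow> 'w \<Rightarrow> real) \<Rightarrow> real \<Rightarrow> 'w \<Rightarrow> ereal" where
  "hitting_time Y y \<omega> = Inf (ereal ` {t. 0 \<le> t \<and> Y t \<omega> = y})"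

definition discount :: "real \<Rightarrow> ereal \<Rightarrow> real" where
  "discount lam \<tau> = (if \<tau> = \<infinity> then 0 else exp (- lam * real_of_ereal \<tau>))"

text \<open>The Laplace transform of the hitting time of \<open>y\<close> by the diffusion started at \<open>x\<close>.\<close>

definition hitting_laplace ::
  "'w measure \<Rightarrow> (real \<Rightarrow> real \<Rightarrow> 'w \<Rightarrow> real) \<Rightarrow> real \<Rightarrow> real \<Rightarrow> real \<Rightarrow> real" where
  "hitting_laplace M X lam x y = (LINT \<omega>|M. discount lam (hitting_time (X x) y \<omega>))"

definition normalized_eigenfunction ::
  "(real \<Rightarrow> real) \<Rightarrow> (real \<Rightarrow> real) \<Rightarrow> real \<Rightarrow> (real \<Rightarrow> real) \<Rightarrow> bool" where
  "normalized_eigenfunction a b lam y \<longleftrightarrow>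
     C2 y \<and> (\<forall>x. 0 < y x) \<and> y 0 = 1 \<and> (\<forall>x. generator a b y x = lam * y x)"

definition increasing_eigenfunction ::
  "'w measure \<Rightarrow> (real \<Rightarrow> real \<Rightarrow> 'w \<Rightarrow> real) \<Rightarrow> (real \<Rightarrow> real) \<Rightarrow> (real \<Rightarrow> real) \<Rightarrow>
   real \<Rightarrow> (real \<Rightarrow> real) \<Rightarrow> bool" where
  "increasing_eigenfunction M X a b lam y \<longleftrightarrow>
     normalized_eigenfunction a b lam y \<and> mono y \<and>
     (\<forall>x<0. y x = hitting_laplace M X lam x 0) \<and>
     (\<forall>x\<ge>0. y x = inverse (hitting_laplace M X lam 0 x))"

definition decreasing_eigenfunction ::
  "'w measure \<Rightarrow> (real \<Rightarrow> real \<Rightarrow> 'w \<Rightarrow> real) \<Rightarrow> (real \<Rightarrow> real) \<Rightarrow> (real \<Rightarrow> real) \<Rightarrow>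
   real \<Rightarrow> (real \<Rightarrow> real) \<Rightarrow> bool" where
  "decreasing_eigenfunction M X a b lam y \<longleftrightarrow>
     normalized_eigenfunction a b lam y \<and> antimono y \<and>
     (\<forall>x\<ge>0. y x = hitting_laplace M X lam x 0) \<and>
     (\<forall>x<0. y x = inverse (hitting_laplace M X lam 0 x))"

section \<open>The local time parameter\<close>

text \<open>The families \<open>yp\<close> and \<open>ym\<close> are indexed by \<open>lam > 0\<close>.\<close>

definition psi_plus :: "(real \<Rightarrow> real \<Rightarrow> real) \<Rightarrow> real \<Rightarrow> real" where
  "psi_plus yp x = 1 / 2 * Lim (at_right 0) (\<lambda>lam. deriv (yp lam) x / yp lam x)"

definition psi_minus :: "(real \<Rightarrow> real \<Rightarrow> real) \<Rightarrow> real \<Rightarrow> real" where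
  "psi_minus ym x = - (1 / 2) * Lim (at_right 0) (\<lambda>lam. deriv (ym lam) x / ym lam x)"

definition psi :: "(real \<Rightarrow> real \<Rightarrow> real) \<Rightarrow> (real \<Rightarrow> real \<Rightarrow> real) \<Rightarrow> real \<Rightarrow> real" where
  "psi yp ym x = psi_plus yp x + psi_minus ym x"

end

theory Submission
  imports Defs
begin

text \<open>
  Write \<open>S = Phi a b x\<close>, \<open>\<phi> = S'\<close> and \<open>m = 2 / (a\<^sup>2 \<phi>)\<close>. For an eigenfunction \<open>y\<close> the function
  \<open>g = y' / \<phi>\<close> satisfies \<open>g' = \<lambda> m y\<close>, so an increasing \<open>y\<close> is a convex function of \<open>S\<close>. Comparing
  it with its chords gives, for \<open>z < x\<close>,
  \<open>g x / y x \<le> 1 / (S x - S z) + \<lambda> C z\<close>, and, provided that \<open>y\<close> vanishes at \<open>-\<infinity>\<close>, also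
  \<open>g x / y x \<ge> 1 / (S x - S (-\<infinity>))\<close>; now let \<open>\<lambda> \<rightarrow> 0\<close> and then \<open>z \<rightarrow> -\<infinity>\<close>.

  That \<open>y\<close> vanishes at \<open>-\<infinity>\<close> is where non-explosion enters. By path continuity the process started
  at \<open>0\<close> needs longer and longer to reach \<open>z \<rightarrow> -\<infinity>\<close>, hence the decreasing eigenfunction is unbounded
  there. If \<open>S (-\<infinity>)\<close> is finite, then its derivative with respect to \<open>S\<close> is unbounded too, and
  since the Wronskian of the two eigenfunctions is constant, the increasing one tends to \<open>0\<close>.
  The decreasing eigenfunction is treated by reflection.
\<close>

section \<open>Eigenfunctions in terms of scale and speed\<close>

locale scale_speed =
  fixes \<phi> m S :: "real \<Rightarrow> real"
  assumes scale_density_pos: "0 < \<phi> z"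
    and speed_pos: "0 < m z"
    and speed_cont: "continuous_on UNIV m"
    and scale_deriv: "(S has_real_derivative \<phi> z) (at z)"
begin

text \<open>The equation \<open>L y = lam * y\<close> as a first-order system: \<open>g\<close> is
  the derivative dy/dS, and it changes at rate \<open>lam * y\<close> with respect to the speed
  density \<open>m\<close>.\<close>

definition eigenpair :: "real \<Rightarrow> (real \<Rightarrow> real) \<Rightarrow> (real \<Rightarrow> real) \<Rightarrow> bool" where
  "eigenpair lam y g \<longleftrightarrow> (\<forall>z. 0 < y z \<and> (y has_real_derivative g z * \<phi> z) (at z) \<and>
     (g has_real_derivative lam * m z * y z) (at z))"

lemma eigenpairD:
  assumes "eigenpair lam y g"
  shows "0 < y z" "(y has_real_derivative g z * \<phi> z) (at z)"
    "(g has_real_derivative lam * m z * y z) (at z)"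
  using assms by (auto simp: eigenpair_def)

lemma scale_strict_mono: "u < v \<Longrightarrow> S u < S v"
  using DERIV_pos_imp_increasing[of u v S] scale_deriv scale_density_pos by blast

lemma scale_mono: "u \<le> v \<Longrightarrow> S u \<le> S v"
  using scale_strict_mono by (cases "u = v") (auto simp: less_le)

section \<open>Monotonicity and convexity in the scale variable\<close>

lemma eigenpair_slope_mono:
  assumes "eigenpair lam y g" "0 \<le> lam" "u \<le> v"
  shows "g u \<le> g v"
proof (rule DERIV_nonneg_imp_nondecreasing[OF \<open>u \<le> v\<close>])
  fix z
  have "0 \<le> lam * m z * y z"
    using assms(2) eigenpairD(1)[OF assms(1), of z] speed_pos[of z] by simp
  then show "\<exists>d. (g has_real_derivative d) (at z) \<and> 0 \<le> d"
    using eigenpairD(3)[OF assms(1)] by blast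
qed

lemma eigenpair_slope_nonneg:
  assumes "eigenpair lam y g" "mono y"
  shows "0 \<le> g z"
proof -
  have "0 \<le> g z * \<phi> z"
    using mono_on_imp_deriv_nonneg[of UNIV y, OF _ eigenpairD(2)[OF assms(1)]] assms(2)
    by simp
  then show ?thesis
    using scale_density_pos[of z] by (simp add: zero_le_mult_iff)
qed

lemma eigenpair_slope_nonpos:
  assumes "eigenpair lam y g" "antimono y"
  shows "g z \<le> 0"
proof -
  have "mono (\<lambda>z. - y z)"
    using assms(2) by (auto simp: monotone_def)
  then have "0 \<le> - (g z * \<phi> z)"
    using mono_on_imp_deriv_nonneg[of UNIV "\<lambda>z. - y z", OF _ DERIV_minus[OF eigenpairD(2)[OF assms(1)]]]
    by simp
  then show ?thesis
    using scale_density_pos[of z] by (simp add: mult_le_0_iff)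
qed

text \<open>Convexity in \<open>S\<close>: the tangent at the left end \<open>z\<close> stays below
  \<open>y\<close>, since the difference has derivative \<open>(g w - g z) * \<phi> w\<close> and
  \<open>g\<close> is nondecreasing.\<close>

lemma eigenpair_chord_lower:
  assumes "eigenpair lam y g" "0 \<le> lam" "z \<le> x"
  shows "g z * (S x - S z) \<le> y x - y z"
proof -
  have "y z - g z * S z \<le> y x - g z * S x"
  proof (rule DERIV_nonneg_imp_nondecreasing[OF \<open>z \<le> x\<close>])
    fix w assume "z \<le> w"
    have "((\<lambda>w. y w - g z * S w) has_real_derivative g w * \<phi> w - g z * \<phi> w) (at w)"
      by (auto intro!: derivative_eq_intros eigenpairD(2)[OF assms(1)] scale_deriv)
    moreover have "0 \<le> g w * \<phi> w - g z * \<phi> w"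
      using eigenpair_slope_mono[OF assms(1,2) \<open>z \<le> w\<close>] scale_density_pos[of w]
      by (simp add: mult_right_mono)
    ultimately show "\<exists>d. ((\<lambda>w. y w - g z * S w) has_real_derivative d) (at w) \<and> 0 \<le> d"
      by blast
  qed
  then show ?thesis by (simp add: algebra_simps)
qed

text \<open>The same argument with the tangent at the right end \<open>x\<close>.\<close>

lemma eigenpair_chord_upper:
  assumes "eigenpair lam y g" "0 \<le> lam" "z \<le> x"
  shows "y x - y z \<le> g x * (S x - S z)"
proof -
  have "g x * S z - y z \<le> g x * S x - y x"
  proof (rule DERIV_nonneg_imp_nondecreasing[OF \<open>z \<le> x\<close>])
    fix w assume "w \<le> x"
    have "((\<lambda>w. g x * S w - y w) has_real_derivative g x * \<phi> w - g w * \<phi> w) (at w)"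
      by (auto intro!: derivative_eq_intros eigenpairD(2)[OF assms(1)] scale_deriv)
    moreover have "0 \<le> g x * \<phi> w - g w * \<phi> w"
      using eigenpair_slope_mono[OF assms(1,2) \<open>w \<le> x\<close>] scale_density_pos[of w]
      by (simp add: mult_right_mono)
    ultimately show "\<exists>d. ((\<lambda>w. g x * S w - y w) has_real_derivative d) (at w) \<and> 0 \<le> d"
      by blast
  qed
  then show ?thesis by (simp add: algebra_simps)
qed

text \<open>The slope at \<open>z\<close> is at most a chord slope, and up to \<open>x\<close> it
  grows by at most \<open>lam * K * (x - z) * y x\<close>, with \<open>K\<close> a bound for
  \<open>m\<close>. The constant \<open>C\<close> depends only on \<open>z\<close> and
  \<open>x\<close>, so the error disappears as \<open>lam\<close> tends to 0.\<close>

lemma log_slope_upper: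
  assumes "z < x"
  obtains C where "\<And>lam y g. \<lbrakk>eigenpair lam y g; mono y; 0 \<le> lam\<rbrakk> \<Longrightarrow>
    g x / y x \<le> 1 / (S x - S z) + lam * C"
proof -
  have "compact (m ` {z..x})"
    using speed_cont by (intro compact_continuous_image) (auto intro: continuous_on_subset)
  then obtain K where K: "\<And>w. w \<in> {z..x} \<Longrightarrow> m w \<le> K"
    by (metis bdd_above.unfold bounded_imp_bdd_above compact_imp_bounded image_eqI)
  have "g x / y x \<le> 1 / (S x - S z) + lam * (K * (x - z))"
    if eig: "eigenpair lam y g" and y: "mono y" and lam: "0 \<le> lam" for lam y g
  proof -
    have D: "0 < S x - S z"
      using scale_strict_mono[OF assms] by simp
    obtain w where w: "z < w" "w < x" "g x - g z = (x - z) * (lam * m w * y w)"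
      using MVT2[of z x g "\<lambda>w. lam * m w * y w", OF assms eigenpairD(3)[OF eig]] by blast
    have "m w * y w \<le> K * y x"
      using K[of w] w y speed_pos[of w] eigenpairD(1)[OF eig, of w]
      by (intro mult_mono) (auto simp: monoD less_imp_le intro: order_trans)
    then have "g x - g z \<le> (x - z) * (lam * (K * y x))"
      using w assms lam by (auto intro!: mult_left_mono simp: mult.assoc)
    then have "g x \<le> g z + lam * (K * (x - z)) * y x"
      by (simp add: algebra_simps)
    \<comment> \<open>The chord inequality is weakened by dropping the positive value
      \<open>y z\<close>.\<close>
    moreover have "g z \<le> y x / (S x - S z)"
      using eigenpair_chord_lower[OF eig lam, of z x] assms D eigenpairD(1)[OF eig, of z]
      by (simp add: pos_le_divide_eq)
    ultimately have "g x \<le> (1 / (S x - S z) + lam * (K * (x - z))) * y x"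
      by (simp add: algebra_simps)
    then show ?thesis
      using eigenpairD(1)[OF eig, of x] by (simp add: pos_divide_le_eq)
  qed
  then show thesis by (rule that)
qed

section \<open>Wronskian and decay of the increasing eigenfunction\<close>

lemma wronskian_const:
  assumes "eigenpair lam y g" "eigenpair lam y' g'"
  shows "g u * y' u - y u * g' u = g v * y' v - y v * g' v"
proof -
  \<comment> \<open>\<open>y'\<close> and \<open>g'\<close> name a second solution, not derivatives;
    the terms \<open>lam * m * y * y'\<close> and \<open>g * g' * \<phi>\<close> cancel.\<close>
  have "((\<lambda>z. g z * y' z - y z * g' z) has_real_derivative 0) (at z)" for z
    by (rule derivative_eq_intros eigenpairD[OF assms(1)] eigenpairD[OF assms(2)] refl)+
      (simp add: algebra_simps)
  from DERIV_isconst_all[OF allI, OF this] show ?thesis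
    by metis
qed

lemma eigenpair_tendsto_0_at_bot:
  assumes incr: "eigenpair lam y g" "mono y" and decr: "eigenpair lam y' g'" "antimono y'"
    and lam: "0 \<le> lam"
    and unbounded: "filterlim y' at_top at_bot"
    and bounded: "\<And>z. s \<le> S z"
  shows "(y \<longlongrightarrow> 0) at_bot"
proof (rule order_tendstoI)
  fix e :: real assume "e < 0"
  then show "eventually (\<lambda>z. e < y z) at_bot"
    using eigenpairD(1)[OF incr(1)] by (auto intro!: always_eventually intro: less_trans)
next
  fix e :: real assume e: "0 < e"
  define w where "w = g 0 * y' 0 - y 0 * g' 0"
  \<comment> \<open>\<open>B\<close> is chosen so that \<open>y' z > B\<close> makes the steepness
    \<open>- g' z\<close> exceed \<open>w / e\<close>: the chord from \<open>z\<close> to 0 has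
    scale length at most \<open>S 0 - s\<close>.\<close>
  define B where "B = y' 0 + w / e * (S 0 - s)"
  have "eventually (\<lambda>z. B < y' z \<and> z \<le> 0) at_bot"
    using unbounded by (auto simp: filterlim_at_top_dense intro!: eventually_conj eventually_le_at_bot)
  then show "eventually (\<lambda>z. y z < e) at_bot"
  proof eventually_elim
    case (elim z)
    have "y' 0 - y' z \<ge> g' z * (S 0 - S z)"
      using eigenpair_chord_lower[OF decr(1) lam, of z 0] elim by simp
    then have 1: "w / e * (S 0 - s) < - g' z * (S 0 - S z)"
      using elim by (simp add: B_def algebra_simps)
    have S: "0 \<le> S 0 - S z" "S 0 - S z \<le> S 0 - s"
      using scale_mono[of z 0] elim bounded[of z] by auto
    have "- g' z * (S 0 - S z) \<le> - g' z * (S 0 - s)"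
      using eigenpair_slope_nonpos[OF decr, of z] S by (intro mult_left_mono) auto
    with 1 have "w / e * (S 0 - s) < - g' z * (S 0 - s)" by simp
    then have "w / e < - g' z"
      by (rule mult_right_less_imp_less) (use S in simp)
    then have "w < e * (- g' z)"
      using e by (simp add: pos_divide_less_eq mult.commute)
    \<comment> \<open>Both summands of the Wronskian are nonnegative, so each is at most
      \<open>w\<close>.\<close>
    moreover have "y z * (- g' z) \<le> w"
    proof -
      have "w = g z * y' z - y z * g' z"
        unfolding w_def by (rule wronskian_const[OF incr(1) decr(1)])
      moreover have "0 \<le> g z * y' z"
        using eigenpair_slope_nonneg[OF incr, of z] eigenpairD(1)[OF decr(1), of z] by simp
      ultimately show ?thesis by simp
    qed
    ultimately have "y z * (- g' z) < e * (- g' z)" by simp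
    then show "y z < e"
      using eigenpair_slope_nonpos[OF decr, of z] by (auto simp: mult_less_cancel_right)
  qed
qed

text \<open>Limit of the chord inequality with slope \<open>g x\<close> as \<open>z\<close> tends to
  \<open>-\<infinity>\<close>, where \<open>y\<close> vanishes and \<open>S\<close> tends to
  \<open>s\<close>.\<close>

lemma log_slope_lower:
  assumes "eigenpair lam y g" "mono y" "eigenpair lam y' g'" "antimono y'" "0 \<le> lam"
    and "filterlim y' at_top at_bot" and S: "(S \<longlongrightarrow> s) at_bot"
  shows "1 / (S x - s) \<le> g x / y x"
proof -
  have s: "s \<le> S z" for z
  proof (rule tendsto_upperbound[OF S])
    show "eventually (\<lambda>w. S w \<le> S z) at_bot"
      using eventually_le_at_bot[of z] by eventually_elim (rule scale_mono)
  qed simp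
  have "(y \<longlongrightarrow> 0) at_bot"
    by (rule eigenpair_tendsto_0_at_bot) (use assms s in auto)
  then have "y x - 0 \<le> g x * (S x - s)"
  proof (intro tendsto_le[OF _ tendsto_mult[OF tendsto_const tendsto_diff[OF tendsto_const S]]
      tendsto_diff[OF tendsto_const]])
    show "eventually (\<lambda>z. y x - y z \<le> g x * (S x - S z)) at_bot"
      using eventually_le_at_bot[of x]
      by eventually_elim (rule eigenpair_chord_upper[OF assms(1,5)])
  qed auto
  \<comment> \<open>Strictness, needed to divide, comes from one further step to the left.\<close>
  moreover have "s < S x"
    using s[of "x - 1"] scale_strict_mono[of "x - 1" x] by simp
  ultimately show ?thesis
    using eigenpairD(1)[OF assms(1), of x] by (simp add: field_simps)
qed

section \<open>Passage to the limit\<close>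

lemma scale_tendsto_at_bot: "((\<lambda>z. ereal (S z)) \<longlongrightarrow> (INF z. ereal (S z))) at_bot"
proof (rule order_tendstoI)
  fix e assume "e < (INF z. ereal (S z))"
  then show "eventually (\<lambda>z. e < ereal (S z)) at_bot"
    by (auto intro!: always_eventually intro: less_le_trans INF_lower)
next
  fix e assume "(INF z. ereal (S z)) < e"
  then obtain w where w: "ereal (S w) < e" by (auto simp: INF_less_iff)
  show "eventually (\<lambda>z. ereal (S z) < e) at_bot"
    using eventually_le_at_bot[of w]
    by eventually_elim (metis w scale_mono ereal_less_eq(3) le_less_trans)
qed

text \<open>Upper bounds depending on \<open>z\<close> and a lower bound valid for every
  \<open>lam\<close> meet at the same \<open>l\<close>. In \<open>ereal\<close> one formula also
  covers infinite scale, where \<open>l\<close> is 0.\<close>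

theorem log_slope_limit:
  assumes incr: "\<And>lam. 0 < lam \<Longrightarrow> eigenpair lam (y lam) (g lam)" "\<And>lam. 0 < lam \<Longrightarrow> mono (y lam)"
    and decr: "\<And>lam. 0 < lam \<Longrightarrow> eigenpair lam (y' lam) (g' lam)"
      "\<And>lam. 0 < lam \<Longrightarrow> antimono (y' lam)"
      "\<And>lam. 0 < lam \<Longrightarrow> filterlim (y' lam) at_top at_bot"
  obtains l where "((\<lambda>lam. g lam x / y lam x) \<longlongrightarrow> l) (at_right 0)"
    "ereal l = 1 / (ereal (S x) - Lim at_bot (\<lambda>z. ereal (S z)))"
proof -
  define e where "e = (INF z. ereal (S z))"
  have Se: "((\<lambda>z. ereal (S z)) \<longlongrightarrow> e) at_bot"
    unfolding e_def by (rule scale_tendsto_at_bot)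
  have e_less: "e < ereal (S x)"
    using INF_lower[of "x - 1" UNIV "\<lambda>z. ereal (S z)"] scale_strict_mono[of "x - 1" x]
    by (auto simp: e_def intro: le_less_trans)
  obtain l where l: "((\<lambda>z. 1 / (S x - S z)) \<longlongrightarrow> l) at_bot" "ereal l = 1 / (ereal (S x) - e)"
    "\<And>lam. 0 < lam \<Longrightarrow> l \<le> g lam x / y lam x"
  proof (cases e)
    case (real s)
    have S: "(S \<longlongrightarrow> s) at_bot"
      using Se real by simp
    have "s < S x" using e_less real by simp
    then show thesis
      using real by (intro that[of "1 / (S x - s)"] tendsto_intros S log_slope_lower[OF incr decr(1,2) _ decr(3) S])
        (auto simp: one_ereal_def)
  next
    \<comment> \<open>With infinite scale the lower bound is just the sign of the slope of an
      increasing function.\<close>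
    case MInf
    have "filterlim S at_bot at_bot"
      using Se unfolding MInf tendsto_MInfty filterlim_at_bot_dense by simp
    then have "filterlim (\<lambda>z. S x + - S z) at_top at_bot"
      by (intro filterlim_tendsto_add_at_top[OF tendsto_const] filterlim_uminus_at_top_at_bot[THEN filterlim_compose])
    then have "((\<lambda>z. 1 / (S x - S z)) \<longlongrightarrow> 0) at_bot"
      by (intro tendsto_divide_0[OF tendsto_const]) (auto intro: filterlim_at_top_imp_at_infinity)
    then show thesis
      using MInf eigenpair_slope_nonneg[OF incr] eigenpairD(1)[OF incr(1)]
      by (intro that[of 0]) (auto simp: zero_ereal_def intro!: divide_nonneg_pos)
  qed (use e_less in auto)
  have "((\<lambda>lam. g lam x / y lam x) \<longlongrightarrow> l) (at_right 0)"
  proof (rule order_tendstoI)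
    fix c assume "c < l"
    show "eventually (\<lambda>lam. c < g lam x / y lam x) (at_right 0)"
      using eventually_at_right_less[of "0::real"]
      by eventually_elim (use l(3) \<open>c < l\<close> in \<open>auto intro: less_le_trans\<close>)
  next
    fix c assume "l < c"
    \<comment> \<open>\<open>z\<close> is fixed first, from the limit of the upper bounds; only then
      is \<open>lam\<close> made small, since \<open>C\<close> depends on \<open>z\<close>.\<close>
    have "eventually (\<lambda>z. 1 / (S x - S z) < c \<and> z < x) at_bot"
      using order_tendstoD(2)[OF l(1) \<open>l < c\<close>] by (auto intro: eventually_conj eventually_gt_at_bot)
    then obtain z where z: "1 / (S x - S z) < c" "z < x"
      by (auto dest!: eventually_happens)
    obtain C where C: "\<And>lam y g. \<lbrakk>eigenpair lam y g; mono y; 0 \<le> lam\<rbrakk> \<Longrightarrow>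
        g x / y x \<le> 1 / (S x - S z) + lam * C"
      using log_slope_upper[OF z(2)] by blast
    have "((\<lambda>lam. 1 / (S x - S z) + lam * C) \<longlongrightarrow> 1 / (S x - S z) + 0 * C) (at_right 0)"
      by (intro tendsto_intros)
    then have "eventually (\<lambda>lam. 1 / (S x - S z) + lam * C < c) (at_right 0)"
      using z(1) by (intro order_tendstoD(2)) auto
    then show "eventually (\<lambda>lam. g lam x / y lam x < c) (at_right 0)"
      using eventually_at_right_less[of "0::real"]
      by eventually_elim (meson C incr le_less_trans less_imp_le)
  qed
  moreover have "Lim at_bot (\<lambda>z. ereal (S z)) = e"
    by (rule tendsto_Lim[OF _ Se]) simp
  ultimately show thesis
    using that l(2) by simp
qed

section \<open>Reflection, exchanging the two ends of the line\<close>

lemma reflection: "scale_speed (\<lambda>z. \<phi> (- z)) (\<lambda>z. m (- z)) (\<lambda>z. - S (- z))"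
proof
  show "continuous_on UNIV (\<lambda>z. m (- z))"
    by (intro continuous_on_compose2[OF speed_cont] continuous_intros) auto
  show "((\<lambda>z. - S (- z)) has_real_derivative \<phi> (- z)) (at z)" for z
    by (auto intro!: derivative_eq_intros DERIV_chain2[OF scale_deriv])
qed (rule scale_density_pos speed_pos)+

text \<open>The reflected scale is again increasing while the argument of \<open>y\<close> is
  reversed, so the slope changes sign.\<close>

lemma eigenpair_reflection:
  assumes "eigenpair lam y g"
  shows "scale_speed.eigenpair (\<lambda>z. \<phi> (- z)) (\<lambda>z. m (- z)) lam (\<lambda>z. y (- z)) (\<lambda>z. - g (- z))"
  unfolding scale_speed.eigenpair_def[OF reflection]
proof (intro allI conjI)
  fix z
  have neg: "(uminus has_real_derivative -1) (at z)"
    by (auto intro!: derivative_eq_intros)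
  show "0 < y (- z)"
    by (rule eigenpairD(1)[OF assms])
  show "((\<lambda>z. y (- z)) has_real_derivative - g (- z) * \<phi> (- z)) (at z)"
    using DERIV_chain2[OF eigenpairD(2)[OF assms] neg] by simp
  show "((\<lambda>z. - g (- z)) has_real_derivative lam * m (- z) * y (- z)) (at z)"
    using DERIV_minus[OF DERIV_chain2[OF eigenpairD(3)[OF assms] neg]] by simp
qed

end

section \<open>The scale function of a diffusion\<close>

lemma interval_lebesgue_integral_deriv:
  fixes f :: "real \<Rightarrow> real" and c z :: real
  assumes "continuous_on UNIV f"
  shows "((\<lambda>u. LBINT w=c..u. f w) has_real_derivative f z) (at z)"
proof -
  \<comment> \<open>The margin 1 puts \<open>z\<close> in the interior, so the derivative within the
    interval is the full one; \<open>min\<close> and \<open>max\<close> allow \<open>z\<close> on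
    either side of \<open>c\<close>.\<close>
  define l r :: real where "l = min c z - 1" and "r = max c z + 1"
  have "((\<lambda>u. LBINT w=c..u. f w) has_vector_derivative f z) (at z within {l..r})"
    using assms by (intro interval_integral_FTC2) (auto simp: l_def r_def intro: continuous_on_subset)
  then show ?thesis
    by (subst (asm) at_within_Icc_at) (auto simp: l_def r_def has_real_derivative_iff_has_vector_derivative)
qed

context
  fixes a b :: "real \<Rightarrow> real"
  assumes cont: "continuous_on UNIV a" "continuous_on UNIV b" and nz: "\<And>x. a x \<noteq> 0"
begin

lemma phi_deriv: "(phi a b x0 has_real_derivative - 2 * b z / (a z)\<^sup>2 * phi a b x0 z) (at z)"
proof -
  have "continuous_on UNIV (\<lambda>u. b u / (a u)\<^sup>2)"
    using cont nz by (intro continuous_intros) auto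
  from interval_lebesgue_integral_deriv[OF this] show ?thesis
    unfolding phi_def[abs_def] by (auto intro!: derivative_eq_intros)
qed

lemma scale_speed_Phi:
  "scale_speed (phi a b x0) (\<lambda>z. 2 / ((a z)\<^sup>2 * phi a b x0 z)) (Phi a b x0)"
proof
  have phi_cont: "continuous_on UNIV (phi a b x0)"
    using phi_deriv by (intro continuous_at_imp_continuous_on) (auto intro: DERIV_isCont)
  show "0 < phi a b x0 z" for z
    by (simp add: phi_def)
  then show "0 < 2 / ((a z)\<^sup>2 * phi a b x0 z)" for z
    using nz by simp
  show "continuous_on UNIV (\<lambda>z. 2 / ((a z)\<^sup>2 * phi a b x0 z))"
    using nz by (intro continuous_intros cont phi_cont) (simp add: phi_def)
  show "(Phi a b x0 has_real_derivative phi a b x0 z) (at z)" for z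
    unfolding Phi_def[abs_def] by (rule interval_lebesgue_integral_deriv[OF phi_cont])
qed

text \<open>Dividing the derivative of \<open>y\<close> by the integrating factor \<open>phi\<close>
  absorbs the drift: the quotient has derivative \<open>2 / (a^2 * phi)\<close> times the generator
  applied to \<open>y\<close>.\<close>

lemma normalized_eigenfunction_eigenpair:
  assumes "normalized_eigenfunction a b lam y"
  shows "scale_speed.eigenpair (phi a b x0) (\<lambda>z. 2 / ((a z)\<^sup>2 * phi a b x0 z)) lam y
    (\<lambda>z. deriv y z / phi a b x0 z)"
  unfolding scale_speed.eigenpair_def[OF scale_speed_Phi]
proof (intro allI conjI)
  fix z
  have C2: "C2 y" and gen: "generator a b y z = lam * y z" and pos: "0 < y z"
    using assms by (auto simp: normalized_eigenfunction_def)
  show "0 < y z" by (rule pos)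
  have phi: "phi a b x0 z \<noteq> 0" by (simp add: phi_def)
  show "(y has_real_derivative deriv y z / phi a b x0 z * phi a b x0 z) (at z)"
    using C2 phi by (auto simp: C2_def differentiable_on_def DERIV_deriv_iff_real_differentiable)
  have "(deriv y has_real_derivative deriv (deriv y) z) (at z)"
    using C2 by (auto simp: C2_def differentiable_on_def DERIV_deriv_iff_real_differentiable)
  then have "((\<lambda>z. deriv y z / phi a b x0 z) has_real_derivative
    (deriv (deriv y) z + 2 * b z / (a z)\<^sup>2 * deriv y z) / phi a b x0 z) (at z)"
    by (rule DERIV_cong[OF DERIV_divide[OF _ phi_deriv phi]]) (use phi nz in \<open>simp add: field_simps\<close>)
  moreover have "deriv (deriv y) z + 2 * b z / (a z)\<^sup>2 * deriv y z = 2 * (lam * y z) / (a z)\<^sup>2"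
    unfolding gen[symmetric] generator_def using nz by (simp add: field_simps)
  ultimately show "((\<lambda>z. deriv y z / phi a b x0 z) has_real_derivative
      lam * (2 / ((a z)\<^sup>2 * phi a b x0 z)) * y z) (at z)"
    by (simp add: ac_simps)
qed

end

section \<open>Hitting times of distant points\<close>

lemma discount_nonneg: "0 \<le> discount lam t"
  by (simp add: discount_def)

lemma discount_hitting_time_le:
  assumes "0 < lam" "0 \<le> T" "\<And>t. t \<in> {0..T} \<Longrightarrow> Y t \<omega> \<noteq> z"
  shows "discount lam (hitting_time Y z \<omega>) \<le> exp (- lam * T)"
proof -
  have le: "ereal T \<le> hitting_time Y z \<omega>"
    unfolding hitting_time_def using assms(3) by (intro Inf_greatest) (force simp: not_le[symmetric])
  show ?thesis
  proof (cases "hitting_time Y z \<omega>")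
    case (real t)
    then show ?thesis using le assms(1) by (simp add: discount_def)
  qed (use le in \<open>auto simp: discount_def\<close>)
qed

lemma discount_hitting_time_le_1:
  assumes "0 < lam"
  shows "discount lam (hitting_time Y z \<omega>) \<le> 1"
proof -
  have "0 \<le> hitting_time Y z \<omega>"
    unfolding hitting_time_def by (intro Inf_greatest) auto
  then show ?thesis
    using assms by (cases "hitting_time Y z \<omega>") (auto simp: discount_def)
qed

text \<open>A continuous path is bounded on \<open>{0..T}\<close>, so distant points are not hit up
  to time \<open>T\<close>.\<close>

lemma discount_hitting_time_tendsto_0:
  assumes lam: "0 < lam" and path: "continuous_on {0..} (\<lambda>t. Y t \<omega>)"
    and f: "filterlim f at_infinity G"
  shows "((\<lambda>k. discount lam (hitting_time Y (f k) \<omega>)) \<longlongrightarrow> 0) G"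
proof (rule order_tendstoI)
  fix c :: real assume "c < 0"
  then show "eventually (\<lambda>k. c < discount lam (hitting_time Y (f k) \<omega>)) G"
    by (auto intro!: always_eventually intro: less_le_trans discount_nonneg)
next
  fix c :: real assume c: "0 < c"
  \<comment> \<open>This makes \<open>exp (- lam * T) \<le> c * exp (- lam) < c\<close>; the
    \<open>max\<close> keeps \<open>T\<close> nonnegative.\<close>
  define T where "T = max 0 (1 - ln c / lam)"
  have T: "0 \<le> T" "exp (- lam * T) < c"
  proof -
    show "0 \<le> T" by (simp add: T_def)
    have "- lam * T \<le> - lam * (1 - ln c / lam)"
      using lam by (intro mult_left_mono_neg) (auto simp: T_def)
    also have "\<dots> < ln c" using lam by (simp add: algebra_simps)
    finally show "exp (- lam * T) < c" using c by (metis exp_less_mono exp_ln)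
  qed
  have "bounded ((\<lambda>t. Y t \<omega>) ` {0..T})"
    by (intro compact_imp_bounded compact_continuous_image continuous_on_subset[OF path]) auto
  then obtain B where B: "\<And>t. t \<in> {0..T} \<Longrightarrow> norm (Y t \<omega>) \<le> B"
    unfolding bounded_iff by blast
  have "eventually (\<lambda>k. B + 1 \<le> norm (f k)) G"
    using filterlim_at_infinity_imp_norm_at_top[OF f] by (simp add: filterlim_at_top)
  then show "eventually (\<lambda>k. discount lam (hitting_time Y (f k) \<omega>) < c) G"
  proof eventually_elim
    case (elim k)
    have "Y t \<omega> \<noteq> f k" if "t \<in> {0..T}" for t
      using B[OF that] elim by auto
    from discount_hitting_time_le[where Y = Y, OF lam T(1) this] T(2) show ?case by simp
  qed
qed

text \<open>
  The hypothesis that the transforms are positive provides the measurability of the discounted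
  hitting times: otherwise the integrals would be \<open>0\<close>.
\<close>

lemma hitting_laplace_tendsto_0:
  assumes "prob_space M" "0 < lam" and path: "continuous_process M (X x)"
    and pos: "\<And>k. 0 < hitting_laplace M X lam x (f k)"
    and f: "filterlim f at_infinity sequentially"
  shows "(\<lambda>k. hitting_laplace M X lam x (f k)) \<longlonglongrightarrow> 0"
proof -
  interpret prob_space M by fact
  have "(\<lambda>k. hitting_laplace M X lam x (f k)) \<longlonglongrightarrow> (LINT \<omega>|M. 0)"
    unfolding hitting_laplace_def
  proof (rule integral_dominated_convergence[where w = "\<lambda>_. 1"])
    show "(\<lambda>\<omega>. discount lam (hitting_time (X x) (f k) \<omega>)) \<in> borel_measurable M" for k
      using pos[of k] not_integrable_integral_eq unfolding hitting_laplace_def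
      by (metis borel_measurable_integrable less_irrefl)
    show "AE \<omega> in M. (\<lambda>k. discount lam (hitting_time (X x) (f k) \<omega>)) \<longlonglongrightarrow> 0"
      using path unfolding continuous_process_def
      by eventually_elim (rule discount_hitting_time_tendsto_0[OF assms(2) _ f])
    show "AE \<omega> in M. norm (discount lam (hitting_time (X x) (f k) \<omega>)) \<le> 1" for k
      by (intro always_eventually) (simp add: discount_nonneg discount_hitting_time_le_1[OF assms(2)])
  qed auto
  then show ?thesis by simp
qed

text \<open>Positivity of \<open>y\<close> forces the transforms to be positive; they tend to 0, so
  their reciprocals tend to \<open>+\<infinity>\<close>.\<close>

lemma inverse_hitting_laplace_at_top:
  assumes "prob_space M" "0 < lam" "continuous_process M (X x)"
    and "\<And>k. y (f k) = inverse (hitting_laplace M X lam x (f k))" "\<And>k. 0 < y (f k)"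
    and "filterlim f at_infinity sequentially"
  shows "filterlim (\<lambda>k. y (f k)) at_top sequentially"
proof -
  have pos: "0 < hitting_laplace M X lam x (f k)" for k
    using assms(4,5)[of k] by simp
  have "(\<lambda>k. hitting_laplace M X lam x (f k)) \<longlonglongrightarrow> 0"
    by (rule hitting_laplace_tendsto_0) (use assms pos in auto)
  then show ?thesis
    unfolding assms(4) using pos
    by (intro filterlim_inverse_at_top) auto
qed

text \<open>Passes from the sequences on which dominated convergence works to the full
  limit.\<close>

lemma mono_filterlim_at_top:
  fixes y :: "real \<Rightarrow> real"
  assumes "mono y" "filterlim (\<lambda>k. y (f k)) at_top sequentially"
  shows "filterlim y at_top at_top"
  unfolding filterlim_at_top
proof
  fix Z
  obtain k where k: "Z \<le> y (f k)"
    using assms(2) by (auto simp: filterlim_at_top dest!: spec[of _ Z] eventually_happens)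
  show "eventually (\<lambda>z. Z \<le> y z) at_top"
    using eventually_ge_at_top[of "f k"]
    by eventually_elim (use k monoD[OF assms(1)] in \<open>blast intro: order_trans\<close>)
qed

lemma increasing_eigenfunction_at_top:
  assumes "prob_space M" "0 < lam" "continuous_process M (X 0)"
    and y: "increasing_eigenfunction M X a b lam y"
  shows "filterlim y at_top at_top"
proof -
  have "filterlim (\<lambda>k. y (real k)) at_top sequentially"
  proof (rule inverse_hitting_laplace_at_top[where X = X and x = 0 and y = y and f = real, OF assms(1-3)])
    show "filterlim real at_infinity sequentially"
      by (rule filterlim_at_top_imp_at_infinity[OF filterlim_real_sequentially])
    show "0 < y (real k)" for k
      using y unfolding increasing_eigenfunction_def normalized_eigenfunction_def by blast
  qed (use y in \<open>auto simp: increasing_eigenfunction_def\<close>)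
  moreover have "mono y"
    using y by (simp add: increasing_eigenfunction_def)
  ultimately show ?thesis
    by (intro mono_filterlim_at_top)
qed

lemma decreasing_eigenfunction_at_bot:
  assumes "prob_space M" "0 < lam" "continuous_process M (X 0)"
    and y: "decreasing_eigenfunction M X a b lam y"
  shows "filterlim y at_top at_bot"
proof -
  have "filterlim (\<lambda>k. y (- real (Suc k))) at_top sequentially"
  \<comment> \<open>\<open>Suc\<close> keeps the points strictly negative: at 0 the decreasing
    eigenfunction is represented by the transform itself, not its reciprocal.\<close>
  proof (rule inverse_hitting_laplace_at_top[where X = X and x = 0 and y = y and f = "\<lambda>k. - real (Suc k)", OF assms(1-3)])
    have "filterlim (\<lambda>k. real (Suc k)) at_top sequentially"
      by (rule filterlim_compose[OF filterlim_real_sequentially filterlim_Suc])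
    then show "filterlim (\<lambda>k. - real (Suc k)) at_infinity sequentially"
      by (intro filterlim_at_bot_imp_at_infinity) (simp only: filterlim_uminus_at_top)
    show "0 < y (- real (Suc k))" for k
      using y unfolding decreasing_eigenfunction_def normalized_eigenfunction_def by blast
  qed (use y in \<open>auto simp: decreasing_eigenfunction_def\<close>)
  then have "filterlim (\<lambda>z. y (- z)) at_top at_top"
    using y by (intro mono_filterlim_at_top[where f = "\<lambda>k. real (Suc k)"])
      (auto simp: decreasing_eigenfunction_def monotone_def)
  then show ?thesis
    by (simp add: filterlim_at_bot_mirror)
qed

section \<open>Combining the two ends\<close>

theorem theorem1:
  fixes M :: "'w measure" and F :: "real \<Rightarrow> 'w measure"
    and W :: "real \<Rightarrow> 'w \<Rightarrow> real" and X :: "real \<Rightarrow> real \<Rightarrow> 'w \<Rightarrow> real"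
    and a b :: "real \<Rightarrow> real" and yp ym :: "real \<Rightarrow> real \<Rightarrow> real"
  assumes "complete_filtered_prob_space M F"
    and "wiener_process M F W"
    and "continuous_on UNIV a" and "continuous_on UNIV b" and "\<And>x. a x \<noteq> 0"
    and "\<And>x. sde_solution M F W a b x (X x)"
    and "transient_coeffs a b"
    and "\<And>lam. lam > 0 \<Longrightarrow> increasing_eigenfunction M X a b lam (yp lam)"
    and "\<And>lam. lam > 0 \<Longrightarrow> decreasing_eigenfunction M X a b lam (ym lam)"
  shows "\<forall>x. (\<exists>l. ((\<lambda>lam. deriv (yp lam) x / yp lam x) \<longlongrightarrow> l) (at_right 0)) \<and>
             (\<exists>l. ((\<lambda>lam. deriv (ym lam) x / ym lam x) \<longlongrightarrow> l) (at_right 0)) \<and>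
             ereal (psi yp ym x) = 1 / 2 * (1 / Phi_pinf a b x - 1 / Phi_minf a b x)"
proof
  fix x
  have prob: "prob_space M"
    using assms(1) by (simp add: complete_filtered_prob_space_def)
  have path: "continuous_process M (X 0)"
    using assms(6)[of 0] by (simp add: sde_solution_def)
  let ?\<phi> = "phi a b x" and ?S = "Phi a b x"
  let ?m = "\<lambda>z. 2 / ((a z)\<^sup>2 * ?\<phi> z)"
  let ?gp = "\<lambda>lam z. deriv (yp lam) z / ?\<phi> z" and ?gm = "\<lambda>lam z. deriv (ym lam) z / ?\<phi> z"
  interpret L: scale_speed ?\<phi> ?m ?S
    by (rule scale_speed_Phi[OF assms(3-5)])
  interpret R: scale_speed "\<lambda>z. ?\<phi> (- z)" "\<lambda>z. ?m (- z)" "\<lambda>z. - ?S (- z)"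
    by (rule L.reflection)
  \<comment> \<open>The scale is based at \<open>x\<close> itself, so at \<open>x\<close> the slope
    with respect to \<open>?S\<close> is the ordinary derivative.\<close>
  have at_x: "?\<phi> x = 1" "?S x = 0"
    by (simp_all add: phi_def Phi_def)
  have eig: "L.eigenpair lam (yp lam) (?gp lam)" "L.eigenpair lam (ym lam) (?gm lam)"
    and mono: "mono (yp lam)" "antimono (ym lam)"
    and lim: "filterlim (yp lam) at_top at_top" "filterlim (ym lam) at_top at_bot"
    if "0 < lam" for lam
    using assms(8,9)[OF that] normalized_eigenfunction_eigenpair[OF assms(3-5)]
      increasing_eigenfunction_at_top[where X = X, OF prob that path]
      decreasing_eigenfunction_at_bot[where X = X, OF prob that path]
    by (auto simp: increasing_eigenfunction_def decreasing_eigenfunction_def)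

  \<comment> \<open>The left end: \<open>yp\<close> is the increasing solution and \<open>ym\<close>
    its companion, unbounded at \<open>-\<infinity>\<close>.\<close>
  obtain lp where lp: "((\<lambda>lam. ?gp lam x / yp lam x) \<longlongrightarrow> lp) (at_right 0)"
    "ereal lp = 1 / (ereal (?S x) - Lim at_bot (\<lambda>z. ereal (?S z)))"
    using L.log_slope_limit[of yp ?gp ym ?gm x] eig mono lim by blast
  have lp_eq: "ereal lp = 1 / - Phi_minf a b x"
    using lp(2) at_x by (simp add: Phi_minf_def flip: zero_ereal_def)

  \<comment> \<open>The right end: after reflection \<open>ym\<close> increases and
    \<open>yp\<close> is the unbounded companion.\<close>
  have "R.eigenpair lam (\<lambda>z. ym lam (- z)) (\<lambda>z. - ?gm lam (- z))"
    "R.eigenpair lam (\<lambda>z. yp lam (- z)) (\<lambda>z. - ?gp lam (- z))"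
    "mono (\<lambda>z. ym lam (- z))" "antimono (\<lambda>z. yp lam (- z))"
    "filterlim (\<lambda>z. yp lam (- z)) at_top at_bot" if "0 < lam" for lam
    using eig[OF that, THEN L.eigenpair_reflection] mono[OF that] lim[OF that]
    by (auto simp: monotone_def filterlim_at_bot_mirror)
  then obtain lm where lm: "((\<lambda>lam. - ?gm lam (- (- x)) / ym lam (- (- x))) \<longlongrightarrow> lm) (at_right 0)"
    "ereal lm = 1 / (ereal (- ?S (- (- x))) - Lim at_bot (\<lambda>z. ereal (- ?S (- z))))"
    using R.log_slope_limit[of "\<lambda>lam z. ym lam (- z)" "\<lambda>lam z. - ?gm lam (- z)"
        "\<lambda>lam z. yp lam (- z)" "\<lambda>lam z. - ?gp lam (- z)" "- x"] by blast
  have pinf: "((\<lambda>z. ereal (?S z)) \<longlongrightarrow> - (INF z. ereal (- ?S (- z)))) at_top"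
    using tendsto_uminus_ereal[OF R.scale_tendsto_at_bot]
    by (simp add: filterlim_at_bot_mirror)
  have "Lim at_bot (\<lambda>z. ereal (- ?S (- z))) = (INF z. ereal (- ?S (- z)))"
    by (rule tendsto_Lim[OF _ R.scale_tendsto_at_bot]) simp
  moreover have "Phi_pinf a b x = - (INF z. ereal (- ?S (- z)))"
    unfolding Phi_pinf_def by (rule tendsto_Lim[OF _ pinf]) simp
  ultimately have lm_eq: "ereal lm = 1 / Phi_pinf a b x"
    using lm(2) at_x by (simp flip: zero_ereal_def)

  have limp: "((\<lambda>lam. deriv (yp lam) x / yp lam x) \<longlongrightarrow> lp) (at_right 0)"
    using lp(1) at_x by simp
  have limm: "((\<lambda>lam. deriv (ym lam) x / ym lam x) \<longlongrightarrow> - lm) (at_right 0)"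
    using tendsto_minus[OF lm(1)] at_x by simp
  have "psi yp ym x = 1 / 2 * (lm + lp)"
    unfolding psi_def psi_plus_def psi_minus_def
    using tendsto_Lim[OF _ limp] tendsto_Lim[OF _ limm] by (simp add: algebra_simps)
  then have psi: "ereal (psi yp ym x) = 1 / 2 * (ereal lm + ereal lp)"
    by (simp add: one_ereal_def numeral_eq_ereal)
  \<comment> \<open>In \<open>ereal\<close> this rule fails at 0, whose reciprocal is
    \<open>\<infinity>\<close>; that case is excluded because \<open>lp\<close> is real.\<close>
  have "1 / - Phi_minf a b x = - (1 / Phi_minf a b x)"
    using lp_eq by (cases "Phi_minf a b x") (auto simp: one_ereal_def split: if_splits)
  then have sum: "ereal lm + ereal lp = 1 / Phi_pinf a b x - 1 / Phi_minf a b x"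
    unfolding lm_eq lp_eq by (simp add: minus_ereal_def)
  show "(\<exists>l. ((\<lambda>lam. deriv (yp lam) x / yp lam x) \<longlongrightarrow> l) (at_right 0)) \<and>
      (\<exists>l. ((\<lambda>lam. deriv (ym lam) x / ym lam x) \<longlongrightarrow> l) (at_right 0)) \<and>
      ereal (psi yp ym x) = 1 / 2 * (1 / Phi_pinf a b x - 1 / Phi_minf a b x)"
    using limp limm psi[unfolded sum] by blast
qed

end
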